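(* Let $\chi$ be an irrational real number with $0<\chi<1$, let $q=\exp(2\pi \mathrm{i}\chi)$, and let $p$ be a real number with $0<p<1$. Let $\sigma$ be the wrapped geometric distribution on the unit circle, i.e. the probability measure having mass $(1-p)p^s$ at the point $q^s$ for each $s=0,1,2,\dots$. Let $\Phi_n(z)=z^n+O(z^{n-1})$, $n=0,1,2,\dots$, be the monic polynomials orthogonal on the unit circle with respect to $\sigma$. Then for every $n=0,1,2,\dots$ $$\Phi_n(z)=\mu_n\;{_2}\phi_1\left({q^{-n},\,pq \atop pq^{1-n}};\,zq\right),$$ where $$\mu_n=q^{-n}\,\frac{(q;q)_n\,(pq^{1-n};q)_n}{(q^{-n};q)_n\,(pq;q)_n}=p^n\,\frac{(p^{-1};q)_n}{(qp;q)_n}.$$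
   Context: The $q$-shifted factorial is $(a;q)_0=1$ and $(a;q)_n=(1-a)(1-aq)\cdots(1-aq^{n-1})$ for $n\ge 1$. The basic hypergeometric function (with base $q$) is $${_2}\phi_1\left({a_1,a_2\atop b_1};z\right)=\sum_{k=0}^{\infty}\frac{(a_1;q)_k(a_2;q)_k}{(q;q)_k(b_1;q)_k}z^k ;$$ when $a_1=q^{-n}$ with $n$ a nonnegative integer, the series terminates and denotes the finite sum over $0\le k\le n$ (note $|q|=1$ here, $q$ not a root of unity). The monic polynomials orthogonal on the unit circle with respect to $\sigma$ are the monic polynomials $\Phi_n$ of degree $n$ such that $$\int \Phi_n(z)\,\overline{\Phi_m(z)}\,\mathrm{d}\sigma(z)=(1-p)\sum_{s=0}^\infty p^s\,\Phi_n(q^s)\,\overline{\Phi_m(q^s)}=h_n\,\delta_{nm},\qquad h_n>0,\quad n,m=0,1,2,\dots.$$ Equivalently, $(1-p)\sum_{s=0}^{\infty}\Phi_n(q^s)q^{-sj}p^s=h_n\delta_{nj}$ for $j=0,1,\dots,n$. *)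

theory Defs
  imports "HOL-Probability.Probability" "HOL-Computational_Algebra.Polynomial"
begin

definition qpoch :: "complex \<Rightarrow> complex \<Rightarrow> nat \<Rightarrow> complex" where
  "qpoch a q n = (\<Prod>k<n. 1 - a * q ^ k)"

text \<open>
  The series is a plain infinite sum; for \<open>a1 = q powi (- int n)\<close> all terms of index above \<open>n\<close>
  vanish and it is the finite sum over \<open>k \<le> n\<close>, see \<open>phi21_terminating\<close>.
\<close>

definition phi21 :: "complex \<Rightarrow> complex \<Rightarrow> complex \<Rightarrow> complex \<Rightarrow> complex \<Rightarrow> complex" where
  "phi21 q a1 a2 b1 z =
     (\<Sum>k. qpoch a1 q k * qpoch a2 q k / (qpoch q q k * qpoch b1 q k) * z ^ k)"

lemma phi21_terminating:
  assumes "q \<noteq> 0"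
  shows "phi21 q (q powi (- int n)) a2 b1 z =
    (\<Sum>k\<le>n. qpoch (q powi (- int n)) q k * qpoch a2 q k / (qpoch q q k * qpoch b1 q k) * z ^ k)"
  unfolding phi21_def
proof (rule suminf_finite)
  fix k assume "k \<notin> {..n}"
  moreover have "q powi (- int n) * q ^ n = 1"
    using assms by (simp add: power_int_minus)
  ultimately have "qpoch (q powi (- int n)) q k = 0"
    unfolding qpoch_def by (intro prod_zero) (auto intro!: bexI[of _ n])
  then show "qpoch (q powi (- int n)) q k * qpoch a2 q k / (qpoch q q k * qpoch b1 q k) * z ^ k = 0"
    by simp
qed simp

text \<open>
  The distribution of \<open>exp (2 \<pi> i \<theta> S)\<close> on the unit circle, where \<open>S\<close> is geometric,
  \<open>P(S = s) = (1 - p) * p ^ s\<close>. The library's parameter of \<open>geometric_pmf\<close> is the success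
  probability, here \<open>1 - p\<close>.
\<close>

definition wrapped_geometric :: "real \<Rightarrow> real \<Rightarrow> complex measure" where
  "wrapped_geometric p \<theta> =
     distr (measure_pmf (geometric_pmf (1 - p))) (restrict_space borel (sphere 0 1))
       (\<lambda>s. exp (2 * of_real pi * \<i> * of_real \<theta>) ^ s)"

lemma wrapped_geometric_measurable:
  "(\<lambda>s::nat. exp (2 * of_real pi * \<i> * of_real \<theta>) ^ s)
     \<in> measure_pmf M \<rightarrow>\<^sub>M restrict_space borel (sphere 0 1)"
  by (auto simp: space_restrict_space norm_power)

lemma prob_space_wrapped_geometric: "prob_space (wrapped_geometric p \<theta>)"
  unfolding wrapped_geometric_def
  by (rule measure_pmf.prob_space_distr[OF wrapped_geometric_measurable])

lemma measure_wrapped_geometric: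
  assumes "0 < p" "p < 1" "\<theta> \<notin> \<rat>"
  shows "measure (wrapped_geometric p \<theta>) {exp (2 * of_real pi * \<i> * of_real \<theta>) ^ s}
           = (1 - p) * p ^ s"
proof -
  define q where "q = exp (2 * of_real pi * \<i> * of_real \<theta>)"
  have nq: "norm (q ^ t) = 1" for t
    by (simp add: q_def norm_power)
  have inj: "t = s" if "q ^ t = q ^ s" for t
  proof (rule ccontr)
    assume ne: "t \<noteq> s"
    have "exp (of_nat t * (2 * of_real pi * \<i> * of_real \<theta>)) =
          exp (of_nat s * (2 * of_real pi * \<i> * of_real \<theta>))"
      using that by (simp add: q_def exp_of_nat_mult)
    then obtain n :: int where n:
      "of_nat t * (2 * of_real pi * \<i> * of_real \<theta>) =
       of_nat s * (2 * of_real pi * \<i> * of_real \<theta>) + of_real (of_int (2 * n) * pi) * \<i>"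
      unfolding exp_eq by (metis of_real_mult of_real_of_int_eq)
    then have "Im (of_nat t * (2 * of_real pi * \<i> * of_real \<theta>)) =
       Im (of_nat s * (2 * of_real pi * \<i> * of_real \<theta>) + of_real (of_int (2 * n) * pi) * \<i>)"
      by (rule arg_cong)
    then have "2 * pi * (real t * \<theta>) = 2 * pi * (real s * \<theta> + of_int n)"
      by (simp add: algebra_simps)
    then have "real t * \<theta> = real s * \<theta> + of_int n"
      by (subst (asm) mult_cancel_left) simp
    then have "(real t - real s) * \<theta> = of_int n"
      by (simp add: algebra_simps)
    then have "\<theta> = of_int n / of_int (int t - int s)"
      using ne by (simp add: field_simps)
    then have "\<theta> \<in> \<rat>"
      by (metis Rats_divide Rats_of_int)
    with assms show False by simp
  qed
  have "{q ^ s} \<in> sets (restrict_space borel (sphere 0 1))"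
    using nq[of s] by (simp add: sets_restrict_space image_iff) (intro bexI[of _ "{q ^ s}"]; auto)
  then have "measure (wrapped_geometric p \<theta>) {q ^ s} =
      measure (measure_pmf (geometric_pmf (1 - p))) ((\<lambda>t. q ^ t) -` {q ^ s})"
    unfolding wrapped_geometric_def q_def
    by (subst measure_distr[OF wrapped_geometric_measurable]) auto
  also have "(\<lambda>t. q ^ t) -` {q ^ s} = {s}"
    using inj by auto
  finally show ?thesis
    using assms by (simp add: q_def measure_pmf_single)
qed

definition monic_opuc :: "complex measure \<Rightarrow> (nat \<Rightarrow> complex poly) \<Rightarrow> bool" where
  "monic_opuc \<sigma> \<Phi> \<longleftrightarrow>
     (\<forall>n. degree (\<Phi> n) = n \<and> lead_coeff (\<Phi> n) = 1) \<and>
     (\<exists>h :: nat \<Rightarrow> real. (\<forall>n. h n > 0) \<and>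
        (\<forall>n m. (LINT z|\<sigma>. poly (\<Phi> n) z * cnj (poly (\<Phi> m) z)) =
                  (if n = m then of_real (h n) else 0)))"

end

theory Submission
  imports Defs
begin

text \<open>
  The moments are \<open>\<integral> z ^ k * cnj z ^ j d\<sigma> = (1 - p) / (1 - p * q ^ (k - j))\<close>. Integrating the
  hypergeometric polynomial against \<open>cnj z ^ j\<close> with \<open>j < n\<close> therefore gives a sum over \<open>k\<close> of the
  \<open>q\<close>-binomial coefficients \<open>(q ^ -n; q)\<^sub>k q ^ k / (q; q)\<^sub>k\<close> times a polynomial in \<open>q ^ k\<close> of degree
  less than \<open>n\<close>, and such sums vanish by the \<open>q\<close>-binomial theorem.
\<close>

section \<open>Identities for q-shifted factorials\<close>

lemma qpoch_Suc: "qpoch a q (Suc k) = qpoch a q k * (1 - a * q ^ k)"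
  by (simp add: qpoch_def)

lemma qpoch_Suc_left: "qpoch a q (Suc k) = (1 - a) * qpoch (a * q) q k"
  unfolding qpoch_def by (subst prod.lessThan_Suc_shift) (simp add: mult.assoc)

lemma qpoch_add: "qpoch a q (m + k) = qpoch a q m * qpoch (a * q ^ m) q k"
  by (induction k) (simp_all add: qpoch_Suc, simp_all add: qpoch_def power_add mult.assoc)

text \<open>Powers of \<open>q\<close> have modulus 1, so \<open>a * q ^ k\<close> keeps the modulus
  of \<open>a\<close> and never meets 1. This keeps the denominators with parameters
  \<open>p * q\<close> and \<open>p * q powi (1 - n)\<close> away from zero.\<close>

lemma qpoch_nonzero:
  assumes "norm q = 1" and "norm a \<noteq> 1"
  shows "qpoch a q n \<noteq> 0"
proof -
  have "a * q ^ k \<noteq> 1" for k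
    using assms by (metis mult.right_neutral norm_mult norm_one norm_power power_one)
  then show ?thesis
    by (auto simp: qpoch_def)
qed

lemma qpoch_self_nonzero:
  assumes "\<And>k. 0 < k \<Longrightarrow> q ^ k \<noteq> 1"
  shows "qpoch q q n \<noteq> 0"
  using assms[of "Suc _"] by (auto simp: qpoch_def)

text \<open>Reading the product backwards: the parameter is a * q^(1-n), so the factor of index
  n-1-i contains a * q^(-i).\<close>

lemma qpoch_reverse:
  assumes "q \<noteq> 0"
  shows "qpoch (a * q * inverse q ^ n) q n = (\<Prod>i<n. 1 - a * inverse q ^ i)"
proof -
  have "qpoch (a * q * inverse q ^ n) q n
      = (\<Prod>i<n. 1 - a * q * inverse q ^ n * q ^ (n - Suc i))"
    unfolding qpoch_def by (rule prod.nat_diff_reindex[symmetric])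
  also have "\<dots> = (\<Prod>i<n. 1 - a * inverse q ^ i)"
  proof (rule prod.cong)
    fix i assume "i \<in> {..<n}"
    then have "n = (n - Suc i) + Suc i" by simp
    then have "inverse q ^ n = inverse q ^ (n - Suc i) * inverse q ^ Suc i"
      by (metis power_add)
    then have "q * inverse q ^ n * q ^ (n - Suc i) = inverse q ^ i"
      using assms by (simp add: field_simps)
    then show "1 - a * q * inverse q ^ n * q ^ (n - Suc i) = 1 - a * inverse q ^ i"
      by (simp add: mult.assoc)
  qed simp
  finally show ?thesis .
qed

text \<open>After reversal, each factor is rewritten as 1 - x = -x * (1 - 1/x) with x = a *
  q^(-i).\<close>

lemma qpoch_invert:
  assumes "q \<noteq> 0" and "a \<noteq> 0"
  shows "qpoch (a * q * inverse q ^ n) q n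
    = (\<Prod>i<n. - (a * inverse q ^ i)) * qpoch (inverse a) q n"
  using assms by (subst qpoch_reverse) (auto simp: qpoch_def prod.distrib[symmetric] field_simps
      intro!: prod.cong)

section \<open>The terminating q-binomial theorem and the sums it makes vanish\<close>

text \<open>The coefficients obey a q-Pascal rule, by which passing from n to n+1 multiplies the
  generating polynomial in \<open>w\<close> by the single factor 1 - q^(-n-1) * w.\<close>

lemma q_binomial:
  fixes q w :: complex
  assumes "q \<noteq> 0" and "\<And>k. 0 < k \<Longrightarrow> q ^ k \<noteq> 1"
  shows "(\<Sum>k\<le>n. qpoch (inverse q ^ n) q k / qpoch q q k * w ^ k)
    = (\<Prod>i<n. 1 - inverse q ^ Suc i * w)"
proof (induction n)
  case 0
  then show ?case by (simp add: qpoch_def)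
next
  case (Suc n)
  define c where "c n k = qpoch (inverse q ^ n) q k / qpoch q q k" for n k
  have nz: "qpoch q q k \<noteq> 0" for k
    by (rule qpoch_self_nonzero) (rule assms)
  have rec: "c (Suc n) (Suc k) = c n (Suc k) - inverse q ^ Suc n * c n k" for k
  proof -
    have "inverse q ^ Suc n * q = inverse q ^ n"
      using assms(1) by simp
    then have 1: "qpoch (inverse q ^ Suc n) q (Suc k)
        = (1 - inverse q ^ Suc n) * qpoch (inverse q ^ n) q k"
      by (simp only: qpoch_Suc_left)
    have nz': "1 - q * q ^ k \<noteq> 0"
      using assms(2)[of "Suc k"] by simp
    have 2: "inverse q ^ n = q * inverse q ^ Suc n"
      using assms(1) by simp
    \<comment> \<open>The q-Pascal rule with t = q^(-n-1) and Q = q^k, reduced to the numerator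
      identity (1 - q*t*Q) - t*(1 - q*Q) = 1 - t.\<close>
    have "(1 - t) * A / (C * (1 - q * Q)) = A * (1 - q * t * Q) / (C * (1 - q * Q)) - t * (A / C)"
      if "1 - q * Q \<noteq> 0" and "C \<noteq> 0" for t A C Q :: complex
      using that by (simp add: divide_simps) (simp add: algebra_simps)
    from this[OF nz' nz, of "inverse q ^ Suc n" "qpoch (inverse q ^ n) q k" k] show ?thesis
      unfolding c_def 1 unfolding qpoch_Suc 2[symmetric] .
  qed
  have c0: "c m 0 = 1" for m
    by (simp add: c_def qpoch_def)
  \<comment> \<open>The last factor is 1 - q^(-n) * q^n, so the sum up to n+1 produced by the index
    shift ends at n.\<close>
  have cn: "c n (Suc n) = 0"
    using assms(1) by (simp add: c_def qpoch_Suc power_inverse)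
  have "(\<Sum>k\<le>Suc n. c (Suc n) k * w ^ k) = 1 + (\<Sum>k\<le>n. c (Suc n) (Suc k) * w ^ Suc k)"
    by (subst sum.atMost_Suc_shift) (simp add: c0)
  also have "\<dots> = (1 + (\<Sum>k\<le>n. c n (Suc k) * w ^ Suc k))
      - inverse q ^ Suc n * w * (\<Sum>k\<le>n. c n k * w ^ k)"
    unfolding rec by (simp add: sum_distrib_left sum_subtractf algebra_simps)
  also have "1 + (\<Sum>k\<le>n. c n (Suc k) * w ^ Suc k) = (\<Sum>k\<le>Suc n. c n k * w ^ k)"
    by (subst sum.atMost_Suc_shift) (simp add: c0)
  also have "\<dots> = (\<Sum>k\<le>n. c n k * w ^ k)"
    by (simp add: cn)
  finally have "(\<Sum>k\<le>Suc n. c (Suc n) k * w ^ k)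
      = (1 - inverse q ^ Suc n * w) * (\<Sum>k\<le>n. c n k * w ^ k)"
    by (simp add: algebra_simps)
  with Suc show ?case
    by (simp add: c_def)
qed

text \<open>On a monomial x^m the weight q^k turns the sum into the q-binomial sum at w = q^(m+1),
  whose product contains the zero factor i = m as long as m < n.\<close>

lemma q_binomial_annihilates_poly:
  fixes q :: complex
  assumes "q \<noteq> 0" and "\<And>k. 0 < k \<Longrightarrow> q ^ k \<noteq> 1" and "degree f < n"
  shows "(\<Sum>k\<le>n. qpoch (inverse q ^ n) q k / qpoch q q k * q ^ k * poly f (q ^ k)) = 0"
proof -
  define c where "c k = qpoch (inverse q ^ n) q k / qpoch q q k" for k
  have zero: "(\<Sum>k\<le>n. c k * (q ^ Suc m) ^ k) = 0" if "m < n" for m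
  proof -
    have "(\<Sum>k\<le>n. c k * (q ^ Suc m) ^ k) = (\<Prod>i<n. 1 - inverse q ^ Suc i * q ^ Suc m)"
      unfolding c_def by (rule q_binomial) (use assms in auto)
    also have "\<dots> = 0"
      using that assms(1) by (intro prod_zero bexI[of _ m]) (simp_all add: power_inverse field_simps)
    finally show ?thesis .
  qed
  have "(\<Sum>k\<le>n. c k * q ^ k * poly f (q ^ k))
      = (\<Sum>k\<le>n. \<Sum>m\<le>degree f. coeff f m * (c k * (q ^ Suc m) ^ k))"
    by (simp add: poly_altdef sum_distrib_left power_mult_distrib power_mult[symmetric]
        mult_ac)
  also have "\<dots> = (\<Sum>m\<le>degree f. coeff f m * (\<Sum>k\<le>n. c k * (q ^ Suc m) ^ k))"
    by (subst sum.swap) (simp add: sum_distrib_left)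
  also have "\<dots> = 0"
    using assms(3) by (intro sum.neutral) (auto simp only: zero atMost_iff mult_zero_right)
  finally show ?thesis
    by (simp add: c_def)
qed

text \<open>
  The \<open>k\<close>-dependence of \<open>qpoch (a * q) q k / qpoch (a * q * inverse q ^ n) q k\<close> is that of the
  polynomial \<open>\<Prod>i<n. 1 - a * inverse q ^ i * x\<close> at \<open>x = q ^ k\<close>. Dividing by
  \<open>1 - a * q ^ k * inverse q ^ j\<close> cancels one factor and leaves degree \<open>n - 1\<close>.
\<close>

lemma qpoch_sum_vanishes:
  fixes q a :: complex
  assumes "norm q = 1" and "\<And>k. 0 < k \<Longrightarrow> q ^ k \<noteq> 1" and "norm a \<noteq> 1" and "j < n"
  shows "(\<Sum>k\<le>n. qpoch (inverse q ^ n) q k * qpoch (a * q) q k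
      / (qpoch q q k * qpoch (a * q * inverse q ^ n) q k) * q ^ k
      / (1 - a * (q ^ k * inverse q ^ j))) = 0"
proof -
  have q0: "q \<noteq> 0"
    using assms(1) by auto
  define f where "f = (\<Prod>i\<in>{..<n} - {j}. [:1, - (a * inverse q ^ i):])"
  define b where "b = a * q * inverse q ^ n"
  have "degree f \<le> (\<Sum>i\<in>{..<n} - {j}. degree [:1, - (a * inverse q ^ i):])"
    unfolding f_def by (rule order.trans[OF degree_prod_sum_le]) (simp_all only: o_def finite_lessThan finite_Diff order_refl)
  also have "\<dots> \<le> (\<Sum>i\<in>{..<n} - {j}. 1)"
    by (intro sum_mono) auto
  also have "\<dots> < n"
    using assms(4) by simp
  finally have degf: "degree f < n" .
  have nb: "norm b \<noteq> 1"
    using assms by (simp add: b_def norm_mult norm_power norm_inverse)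
  have nzb: "qpoch b q k \<noteq> 0" for k
    by (rule qpoch_nonzero) (use assms nb in auto)
  have bq: "b * q ^ n = a * q"
    using q0 by (simp add: b_def power_inverse)
  have eq: "qpoch (a * q) q k / qpoch b q k / (1 - a * (q ^ k * inverse q ^ j))
      = poly f (q ^ k) / qpoch b q n" for k
  proof -
    have "norm (a * (q ^ k * inverse q ^ j)) \<noteq> 1"
      using assms by (simp add: norm_mult norm_power norm_inverse)
    then have nz: "1 - a * (q ^ k * inverse q ^ j) \<noteq> 0"
      by (metis eq_iff_diff_eq_0 norm_one)
    \<comment> \<open>Both sides are the factorial of \<open>b\<close> of length n+k, split after n
      and after k factors; \<open>bq\<close> identifies the tail of the first splitting.\<close>
    have "qpoch b q n * qpoch (a * q) q k = qpoch b q k * qpoch (b * q ^ k) q n"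
      using qpoch_add[of b q n k] qpoch_add[of b q k n] by (simp add: add.commute bq)
    moreover have "qpoch (b * q ^ k) q n = (\<Prod>i<n. 1 - a * q ^ k * inverse q ^ i)"
      using qpoch_reverse[OF q0, of "a * q ^ k" n] by (simp add: b_def mult_ac)
    moreover have "(\<Prod>i<n. 1 - a * q ^ k * inverse q ^ i)
        = (1 - a * (q ^ k * inverse q ^ j)) * (\<Prod>i\<in>{..<n} - {j}. 1 - a * q ^ k * inverse q ^ i)"
      using assms(4) by (subst prod.remove[of _ j]) (auto simp: mult.assoc)
    moreover have "(\<Prod>i\<in>{..<n} - {j}. 1 - a * q ^ k * inverse q ^ i) = poly f (q ^ k)"
      by (simp add: f_def poly_prod mult_ac)
    ultimately have "qpoch b q n * qpoch (a * q) q k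
        = qpoch b q k * ((1 - a * (q ^ k * inverse q ^ j)) * poly f (q ^ k))"
      by simp
    then show ?thesis
      using nz nzb[of k] nzb[of n] unfolding divide_divide_eq_left
      by (subst frac_eq_eq) (simp_all only: mult_eq_0_iff mult_ac simp_thms)
  qed
  have "(\<Sum>k\<le>n. qpoch (inverse q ^ n) q k * qpoch (a * q) q k
      / (qpoch q q k * qpoch b q k) * q ^ k / (1 - a * (q ^ k * inverse q ^ j)))
    = (\<Sum>k\<le>n. qpoch (inverse q ^ n) q k / qpoch q q k * q ^ k
      * (qpoch (a * q) q k / qpoch b q k / (1 - a * (q ^ k * inverse q ^ j))))"
    by (intro sum.cong) (simp_all add: mult_ac)
  also have "\<dots> = (\<Sum>k\<le>n. qpoch (inverse q ^ n) q k / qpoch q q k * q ^ k * poly f (q ^ k))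
      / qpoch b q n"
    unfolding eq by (simp add: sum_divide_distrib)
  also have "\<dots> = 0"
    using q_binomial_annihilates_poly[OF q0 assms(2) degf] by simp
  finally show ?thesis
    by (simp add: b_def)
qed

section \<open>Uniqueness of monic orthogonal polynomials\<close>

text \<open>The leading terms of \<open>\<Phi> n\<close> and \<open>P\<close> cancel, so a nonzero
  difference has some degree m < n and is orthogonal to \<open>\<Phi> m\<close>. Its pairing with
  \<open>\<Phi> m\<close> is also its leading coefficient times h m > 0, a contradiction.
  Integrability makes the pairing additive.\<close>

lemma monic_opuc_unique:
  assumes opuc: "monic_opuc \<sigma> \<Phi>"
    and int: "\<And>f g. integrable \<sigma> (\<lambda>z. poly f z * cnj (poly g z))"
    and P: "degree P = n" "lead_coeff P = 1"
    and orth: "\<And>j. j < n \<Longrightarrow> (LINT z|\<sigma>. poly P z * cnj (z ^ j)) = 0"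
  shows "\<Phi> n = P"
proof -
  define ip where "ip f g = (LINT z|\<sigma>. poly f z * cnj (poly g z))" for f g
  obtain h :: "nat \<Rightarrow> real" where h: "\<And>n. h n > 0"
      and ip_Phi: "\<And>n m. ip (\<Phi> n) (\<Phi> m) = (if n = m then of_real (h n) else 0)"
    and deg: "\<And>n. degree (\<Phi> n) = n" and lead: "\<And>n. coeff (\<Phi> n) n = 1"
    using opuc unfolding monic_opuc_def ip_def by metis
  have ip_diff: "ip (f - g) k = ip f k - ip g k" for f g k
    unfolding ip_def using int by (simp add: left_diff_distrib)
  have ip_smult: "ip (smult c f) k = c * ip f k" for c f k
    unfolding ip_def by (simp add: mult.assoc)
  \<comment> \<open>Subtracting the leading multiple of the monic \<open>\<Phi> d\<close> kills the
    top coefficient. The case of zero is separate because the zero polynomial has degree 0, which is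
    not below d = 0.\<close>
  have lower: "f - smult (coeff f d) (\<Phi> d) = 0 \<or> degree (f - smult (coeff f d) (\<Phi> d)) < d"
    if "degree f = d" for f d
    using that by (intro eq_zero_or_degree_less degree_diff_le)
      (auto intro: order.trans[OF degree_smult_le] simp: deg lead)
  have ip_0: "ip 0 k = 0" for k
    by (simp add: ip_def)
  \<comment> \<open>Strong induction on the degree: the peeled-off multiple of
    \<open>\<Phi> (degree f)\<close> is orthogonal to \<open>\<Phi> m\<close>, the remainder by
    induction.\<close>
  have Phi_orth: "degree f < m \<Longrightarrow> ip f (\<Phi> m) = 0" for f m
  proof (induction "degree f" arbitrary: f rule: less_induct)
    case less
    define g where "g = f - smult (coeff f (degree f)) (\<Phi> (degree f))"
    have "ip g (\<Phi> m) = 0"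
      using lower[of f "degree f"] less(1)[of g] less(2) ip_0[of "\<Phi> m"] unfolding g_def[symmetric]
      by auto
    with less(2) show ?case
      by (simp add: g_def ip_diff ip_smult ip_Phi)
  qed
  have P_orth: "ip P g = 0" if "degree g < n" for g
  proof -
    have "integrable \<sigma> (\<lambda>z. cnj (coeff g j) * (poly P z * cnj (z ^ j)))" for j
      using int[of P "monom 1 j"] by (intro integrable_mult_right) (simp add: poly_monom)
    moreover have "poly P z * cnj (poly g z)
        = (\<Sum>j\<le>degree g. cnj (coeff g j) * (poly P z * cnj (z ^ j)))" for z
      by (simp add: poly_altdef sum_distrib_left mult_ac)
    ultimately have "ip P g = (\<Sum>j\<le>degree g. LINT z|\<sigma>. cnj (coeff g j) * (poly P z * cnj (z ^ j)))"
      unfolding ip_def by (simp add: Bochner_Integration.integral_sum)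
    also have "\<dots> = (\<Sum>j\<le>degree g. cnj (coeff g j) * (LINT z|\<sigma>. poly P z * cnj (z ^ j)))"
      by simp
    also have "\<dots> = 0"
      using that orth by (intro sum.neutral) auto
    finally show ?thesis .
  qed
  define D where "D = \<Phi> n - P"
  have "D = 0"
  proof (rule ccontr)
    assume "D \<noteq> 0"
    define m where "m = degree D"
    define c where "c = coeff D m"
    have "c \<noteq> 0"
      using \<open>D \<noteq> 0\<close> by (simp add: c_def m_def)
    have "D = 0 \<or> degree D < n"
      unfolding D_def using P lead[of n] deg[of n]
      by (intro eq_zero_or_degree_less degree_diff_le) auto
    with \<open>D \<noteq> 0\<close> have "m < n"
      by (simp add: m_def)
    then have "ip D (\<Phi> m) = 0"
      using P_orth[of "\<Phi> m"] by (simp add: D_def ip_diff ip_Phi deg)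
    \<comment> \<open>Removing the leading multiple of \<open>\<Phi> m\<close> leaves zero or a
      degree below m, so \<open>Phi_orth\<close> applies; only c * h m survives.\<close>
    moreover have "ip (D - smult c (\<Phi> m)) (\<Phi> m) = 0"
      using lower[of D m] Phi_orth[of "D - smult c (\<Phi> m)" m] ip_0[of "\<Phi> m"] unfolding c_def
      by (auto simp: m_def)
    ultimately have "c * of_real (h m) = 0"
      by (simp add: ip_diff ip_smult ip_Phi)
    with \<open>c \<noteq> 0\<close> h[of m] show False
      by simp
  qed
  then show ?thesis
    by (simp add: D_def)
qed

section \<open>Moments of the wrapped geometric distribution\<close>

text \<open>The circle is compact, so \<open>f\<close> is bounded there, and the measure is
  finite.\<close>

lemma integrable_wrapped_geometric:
  fixes f :: "complex \<Rightarrow> complex"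
  assumes "continuous_on (sphere 0 1) f"
  shows "integrable (wrapped_geometric p \<theta>) f"
proof -
  interpret prob_space "wrapped_geometric p \<theta>"
    by (rule prob_space_wrapped_geometric)
  obtain B where B: "\<And>z. z \<in> sphere 0 1 \<Longrightarrow> norm (f z) \<le> B"
    using compact_imp_bounded[OF compact_continuous_image[OF assms compact_sphere]]
    unfolding bounded_iff by blast
  have "f \<in> borel_measurable (wrapped_geometric p \<theta>)"
    using borel_measurable_continuous_on_restrict[OF assms] by (simp add: wrapped_geometric_def)
  moreover have "space (wrapped_geometric p \<theta>) = sphere 0 1"
    by (simp add: wrapped_geometric_def space_restrict_space)
  ultimately show ?thesis
    using B by (intro integrable_const_bound[of _ B]) auto
qed

text \<open>A geometric series with ratio p * w, of modulus p < 1.\<close>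

lemma geometric_pmf_expectation_power:
  fixes w :: complex
  assumes "0 < p" and "p < 1" and "norm w = 1"
  shows "(LINT s|measure_pmf (geometric_pmf (1 - p)). w ^ s) = of_real (1 - p) / (1 - of_real p * w)"
proof -
  have nm: "norm (of_real p * w) < 1"
    using assms by (simp add: norm_mult)
  have eq: "pmf (geometric_pmf (1 - p)) s *\<^sub>R w ^ s = of_real (1 - p) * (of_real p * w) ^ s" for s
    using assms by (simp add: scaleR_conv_of_real power_mult_distrib)
  have int: "integrable (count_space UNIV) (\<lambda>s. pmf (geometric_pmf (1 - p)) s *\<^sub>R w ^ s)"
    unfolding eq integrable_count_space_nat_iff norm_mult[of "of_real (1 - p)"] norm_power
    using nm by (intro summable_mult summable_geometric) simp
  have "(LINT s|measure_pmf (geometric_pmf (1 - p)). w ^ s)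
      = (LINT s|count_space UNIV. pmf (geometric_pmf (1 - p)) s *\<^sub>R w ^ s)"
    by (simp add: measure_pmf_eq_density integral_density)
  also have "\<dots> = (\<Sum>s. of_real (1 - p) * (of_real p * w) ^ s)"
    using sums_unique[OF sums_integral_count_space_nat[OF int]] unfolding eq by simp
  also have "\<dots> = of_real (1 - p) * (1 / (1 - of_real p * w))"
    using nm by (simp add: suminf_mult summable_geometric suminf_geometric)
  finally show ?thesis
    by simp
qed

text \<open>Conjugation inverts points of the unit circle, so the integrand at q^s is the s-th power
  of q^(k-j).\<close>

lemma wrapped_geometric_moment:
  fixes \<theta> p :: real
  defines "q \<equiv> exp (2 * of_real pi * \<i> * of_real \<theta>)"
  assumes "0 < p" and "p < 1"
  shows "(LINT z|wrapped_geometric p \<theta>. z ^ k * cnj (z ^ j))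
    = of_real (1 - p) / (1 - of_real p * (q ^ k * inverse q ^ j))"
proof -
  have nq: "norm q = 1"
    by (simp add: q_def)
  then have cq: "cnj q = inverse q"
    by (metis complex_norm_square inverse_unique of_real_1 one_power2)
  have "(\<lambda>z. z ^ k * cnj (z ^ j)) \<in> borel_measurable (restrict_space borel (sphere 0 1))"
    by (intro borel_measurable_continuous_on_restrict continuous_intros)
  then have "(LINT z|wrapped_geometric p \<theta>. z ^ k * cnj (z ^ j))
      = (LINT s|measure_pmf (geometric_pmf (1 - p)). (q ^ s) ^ k * cnj ((q ^ s) ^ j))"
    unfolding wrapped_geometric_def q_def
    by (subst integral_distr[OF wrapped_geometric_measurable]) auto
  also have "\<dots> = (LINT s|measure_pmf (geometric_pmf (1 - p)). (q ^ k * inverse q ^ j) ^ s)"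
    by (simp add: cq power_mult_distrib power_mult[symmetric] mult.commute)
  also have "\<dots> = of_real (1 - p) / (1 - of_real p * (q ^ k * inverse q ^ j))"
    using assms nq
    by (intro geometric_pmf_expectation_power) (auto simp: norm_mult norm_power norm_inverse)
  finally show ?thesis .
qed

lemma exp_irrational_not_root_of_unity:
  assumes "\<theta> \<notin> \<rat>" and "0 < k"
  shows "exp (2 * of_real pi * \<i> * of_real \<theta>) ^ k \<noteq> 1"
proof
  assume "exp (2 * of_real pi * \<i> * of_real \<theta>) ^ k = 1"
  then have "exp (of_nat k * (2 * of_real pi * \<i> * of_real \<theta>)) = 1"
    by (simp add: exp_of_nat_mult)
  then obtain n :: int where "real k * (2 * pi * \<theta>) = of_int (2 * n) * pi"
    by (auto simp: exp_eq_1)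
  then have "\<theta> = of_int n / of_nat k"
    using assms(2) by (simp add: field_simps)
  with assms(1) show False
    by simp
qed

section \<open>Normalisation and orthogonality of the hypergeometric polynomial\<close>

theorem theorem2p1:
  fixes \<theta> p :: real and q :: complex
    and \<Phi> :: "nat \<Rightarrow> complex poly" and \<mu> :: "nat \<Rightarrow> complex"
  assumes "\<theta> \<notin> \<rat>" and "0 < \<theta>" and "\<theta> < 1"
    and "q = exp (2 * of_real pi * \<i> * of_real \<theta>)"
    and "0 < p" and "p < 1"
    and "monic_opuc (wrapped_geometric p \<theta>) \<Phi>"
    and "\<And>n. \<mu> n =
           q powi (- int n) *
             (qpoch q q n * qpoch (of_real p * q powi (1 - int n)) q n) /
             (qpoch (q powi (- int n)) q n * qpoch (of_real p * q) q n)"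
  shows "\<forall>n. (\<forall>z. poly (\<Phi> n) z =
                 \<mu> n * phi21 q (q powi (- int n)) (of_real p * q)
                          (of_real p * q powi (1 - int n)) (z * q)) \<and>
             \<mu> n = of_real p ^ n * qpoch (inverse (of_real p)) q n / qpoch (q * of_real p) q n"
proof
  fix n
  have nq: "norm q = 1"
    by (simp add: assms(4))
  then have q0: "q \<noteq> 0" by auto
  have root: "q ^ k \<noteq> 1" if "0 < k" for k
    unfolding assms(4) by (rule exp_irrational_not_root_of_unity) (use assms that in auto)
  define a :: complex where "a = of_real p"
  have a0: "a \<noteq> 0" and na: "norm a \<noteq> 1"
    using assms by (auto simp: a_def)
  have powi: "q powi (- int n) = inverse q ^ n"
    by (simp add: power_int_minus power_inverse)
  have powi': "q powi (1 - int n) = q * inverse q ^ n"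
    using q0 by (simp add: power_int_diff power_inverse divide_inverse)
  have nz: "qpoch q q n \<noteq> 0" "qpoch (a * q) q n \<noteq> 0" "qpoch (a * q * inverse q ^ n) q n \<noteq> 0"
    by (rule qpoch_self_nonzero, erule root)
      (rule qpoch_nonzero; use na nq in \<open>simp add: norm_mult norm_power norm_inverse\<close>)+
  \<comment> \<open>The case a = 1/q of \<open>qpoch_invert\<close>, where a * q cancels and 1/a =
    q.\<close>
  have rev1: "qpoch (inverse q ^ n) q n = (\<Prod>i<n. - (inverse q * inverse q ^ i)) * qpoch q q n"
    using qpoch_invert[OF q0, of "inverse q" n] q0 by simp
  have nz': "qpoch (inverse q ^ n) q n \<noteq> 0"
    unfolding rev1 using nz q0 by simp
  have \<mu>: "\<mu> n = inverse q ^ n * (qpoch q q n * qpoch (a * q * inverse q ^ n) q n) /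
      (qpoch (inverse q ^ n) q n * qpoch (a * q) q n)"
    by (simp add: assms(8) powi powi' a_def mult.assoc)

  have "\<mu> n = a ^ n * qpoch (inverse a) q n / qpoch (a * q) q n"
  proof -
    \<comment> \<open>The two prefactors from \<open>qpoch_invert\<close>, for a and for 1/q, differ
      by (a * q)^n; with the factor q^(-n) of \<open>\<mu> n\<close> this leaves a^n.\<close>
    have "(\<Prod>i<n. - (a * inverse q ^ i)) * inverse q ^ n
        = a ^ n * (\<Prod>i<n. - (inverse q * inverse q ^ i))"
      by (induction n) (simp_all add: algebra_simps)
    then have "inverse q ^ n * qpoch (a * q * inverse q ^ n) q n * qpoch q q n
        = a ^ n * qpoch (inverse a) q n * qpoch (inverse q ^ n) q n"
      unfolding rev1 qpoch_invert[OF q0 a0] by (simp add: mult_ac)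
    then show ?thesis
      unfolding \<mu> using nz nz' by (simp add: frac_eq_eq mult_ac)
  qed
  then have part2: "\<mu> n = of_real p ^ n * qpoch (inverse (of_real p)) q n / qpoch (q * of_real p) q n"
    by (simp add: a_def mult.commute)

  \<comment> \<open>The coefficient of z^k in the series; the factor q^k comes from the argument z *
    q and is the weight the vanishing sums require.\<close>
  define b where "b k = qpoch (inverse q ^ n) q k * qpoch (a * q) q k
      / (qpoch q q k * qpoch (a * q * inverse q ^ n) q k) * q ^ k" for k
  define P where "P = (\<Sum>k\<le>n. monom (\<mu> n * b k) k)"
  have poly_P: "poly P z = (\<Sum>k\<le>n. \<mu> n * b k * z ^ k)" for z
    by (simp add: P_def poly_sum poly_monom)
  have coeff_n: "coeff P n = 1"
  proof -
    \<comment> \<open>\<open>\<mu> n\<close> is exactly the reciprocal of the top coefficient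
      \<open>b n\<close>.\<close>
    have "coeff P n = \<mu> n * b n"
      by (simp add: P_def coeff_sum)
    also have "\<dots> = 1"
      unfolding \<mu> b_def using nz nz' q0 by (simp add: field_simps)
    finally show ?thesis .
  qed
  have deg: "degree P = n"
  proof (rule antisym)
    show "degree P \<le> n"
      unfolding P_def by (intro degree_sum_le) (auto intro: order.trans[OF degree_monom_le])
    show "n \<le> degree P"
      by (rule le_degree) (simp add: coeff_n)
  qed
  have orth: "(LINT z|wrapped_geometric p \<theta>. poly P z * cnj (z ^ j)) = 0" if "j < n" for j
  proof -
    have "(LINT z|wrapped_geometric p \<theta>. poly P z * cnj (z ^ j))
        = (LINT z|wrapped_geometric p \<theta>. (\<Sum>k\<le>n. \<mu> n * b k * (z ^ k * cnj (z ^ j))))"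
      unfolding poly_P by (simp add: sum_distrib_right mult.assoc)
    also have "\<dots> = (\<Sum>k\<le>n. (LINT z|wrapped_geometric p \<theta>. \<mu> n * b k * (z ^ k * cnj (z ^ j))))"
      by (intro Bochner_Integration.integral_sum integrable_wrapped_geometric continuous_intros)
    \<comment> \<open>Each moment contributes the denominator that cancels one linear factor in
      \<open>qpoch_sum_vanishes\<close>.\<close>
    also have "\<dots> = (\<Sum>k\<le>n. \<mu> n * b k * (of_real (1 - p) / (1 - a * (q ^ k * inverse q ^ j))))"
      unfolding integral_mult_right_zero wrapped_geometric_moment[OF assms(5,6)]
        assms(4)[symmetric] a_def ..
    also have "\<dots> = \<mu> n * of_real (1 - p) * (\<Sum>k\<le>n. b k / (1 - a * (q ^ k * inverse q ^ j)))"
      by (simp add: sum_distrib_left mult_ac)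
    also have "\<dots> = 0"
      unfolding b_def using qpoch_sum_vanishes[OF nq root na that] by simp
    finally show ?thesis .
  qed
  have "\<Phi> n = P"
    by (rule monic_opuc_unique[OF assms(7) _ deg _ orth])
      (auto intro!: integrable_wrapped_geometric continuous_intros simp: coeff_n deg)
  then have "poly (\<Phi> n) z = \<mu> n * phi21 q (q powi (- int n)) (of_real p * q)
      (of_real p * q powi (1 - int n)) (z * q)" for z
    unfolding phi21_terminating[OF q0] unfolding powi powi'
    by (simp add: poly_P b_def a_def sum_distrib_left power_mult_distrib mult_ac)
  with part2 show "(\<forall>z. poly (\<Phi> n) z = \<mu> n * phi21 q (q powi (- int n)) (of_real p * q)
      (of_real p * q powi (1 - int n)) (z * q)) \<and>
      \<mu> n = of_real p ^ n * qpoch (inverse (of_real p)) q n / qpoch (q * of_real p) q n"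
    by blast
qed

end
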